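(* Let $(\mathsf{T},\mu,\eta)$ be an idempotent monad on a category $\mathbb{X}$ with finite biproducts. Then $(\mathsf{T},\mu,\eta)$ is a Hopf monad if and only if for all pairs of objects $A,B\in\mathbb{X}$ the following equality holds: $$\mathsf{T}(1_A\oplus 0)+\mathsf{T}(0\oplus 1_{\mathsf{T}(B)})=1_{\mathsf{T}(A\oplus\mathsf{T}(B))},$$ where $1_A\oplus 0$ and $0\oplus 1_{\mathsf{T}(B)}$ are the endomorphisms $\iota_1\circ\pi_1$ and $\iota_2\circ\pi_2$ of $A\oplus\mathsf{T}(B)$.
   Context: In a category $\mathbb{X}$ with finite biproducts, $\oplus$ denotes the biproduct, with injections $\iota_j$ and projections $\pi_j$; $f+g$ denotes the sum of parallel maps and $0$ the zero maps in the induced commutative monoid enrichment (negatives are not assumed). A monad is a triple $(\mathsf{T},\mu,\eta)$ with endofunctor $\mathsf{T}$, multiplication $\mu_A:\mathsf{T}\mathsf{T}(A)\to\mathsf{T}(A)$ and unit $\eta_A:A\to\mathsf{T}(A)$. It is idempotent if $\mu$ is a natural isomorphism (with then $\mu_A^{-1}=\eta_{\mathsf{T}(A)}=\mathsf{T}(\eta_A)$). The fusion operator of a monad $(\mathsf{T},\mu,\eta)$ on $\mathbb{X}$ is the natural transformation $\mathsf{h}_{A,B}:\mathsf{T}(A\oplus\mathsf{T}(B))\to\mathsf{T}(A)\oplus\mathsf{T}(B)$ defined by $\mathsf{h}_{A,B}=\iota_1\circ\mathsf{T}(\pi_1)+\iota_2\circ\mu_B\circ\mathsf{T}(\pi_2)$.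 The monad is a Hopf monad if $\mathsf{h}$ is a natural isomorphism. *)

theory Defs
  imports Main
begin

section \<open>Categories, functors and natural transformations\<close>

text \<open>
  Values of the operations outside the carriers are unconstrained, so every law is guarded.
  Composition is written in the applicative order: \<open>g \<cdot> f\<close> is \<open>g\<close> after \<open>f\<close>.
\<close>

record ('o, 'm) cat =
  Obj :: "'o set"
  Arr :: "'m set"
  Dom :: "'m \<Rightarrow> 'o"
  Cod :: "'m \<Rightarrow> 'o"
  Id :: "'o \<Rightarrow> 'm" ("\<one>\<index>")
  Comp :: "'m \<Rightarrow> 'm \<Rightarrow> 'm" (infixl "\<cdot>\<index>" 70)

definition hom :: "('o, 'm, 'z) cat_scheme \<Rightarrow> 'o \<Rightarrow> 'o \<Rightarrow> 'm set" where
  "hom C A B = {f \<in> Arr C. Dom C f = A \<and> Cod C f = B}"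

locale category =
  fixes C :: "('o, 'm, 'z) cat_scheme" (structure)
  assumes Dom_in_Obj: "f \<in> Arr C \<Longrightarrow> Dom C f \<in> Obj C"
    and Cod_in_Obj: "f \<in> Arr C \<Longrightarrow> Cod C f \<in> Obj C"
    and Id_in_hom: "A \<in> Obj C \<Longrightarrow> \<one> A \<in> hom C A A"
    and Comp_in_hom: "\<lbrakk>f \<in> hom C A B; g \<in> hom C B D\<rbrakk> \<Longrightarrow> g \<cdot> f \<in> hom C A D"
    and Comp_Id_left: "f \<in> hom C A B \<Longrightarrow> \<one> B \<cdot> f = f"
    and Comp_Id_right: "f \<in> hom C A B \<Longrightarrow> f \<cdot> \<one> A = f"
    and Comp_assoc:
      "\<lbrakk>f \<in> hom C A B; g \<in> hom C B D; h \<in> hom C D E\<rbrakk> \<Longrightarrow> h \<cdot> g \<cdot> f = h \<cdot> (g \<cdot> f)"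

definition isomorphism :: "('o, 'm, 'z) cat_scheme \<Rightarrow> 'm \<Rightarrow> bool" where
  "isomorphism C f \<longleftrightarrow> f \<in> Arr C \<and>
    (\<exists>g \<in> hom C (Cod C f) (Dom C f).
      Comp C g f = Id C (Dom C f) \<and> Comp C f g = Id C (Cod C f))"

definition prod_cat ::
    "('o, 'm, 'z) cat_scheme \<Rightarrow> ('p, 'n, 'y) cat_scheme \<Rightarrow> ('o \<times> 'p, 'm \<times> 'n) cat" where
  "prod_cat C D =
    \<lparr> Obj = Obj C \<times> Obj D, Arr = Arr C \<times> Arr D,
      Dom = map_prod (Dom C) (Dom D), Cod = map_prod (Cod C) (Cod D),
      Id = map_prod (Id C) (Id D),
      Comp = (\<lambda>(g, g') (f, f'). (Comp C g f, Comp D g' f')) \<rparr>"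

record ('o, 'm, 'p, 'n) ftor =
  fobj :: "'o \<Rightarrow> 'p"
  farr :: "'m \<Rightarrow> 'n"

definition id_ftor :: "('o, 'm, 'o, 'm) ftor" where
  "id_ftor = \<lparr> fobj = id, farr = id \<rparr>"

definition comp_ftor ::
    "('p, 'n, 'q, 'k) ftor \<Rightarrow> ('o, 'm, 'p, 'n) ftor \<Rightarrow> ('o, 'm, 'q, 'k) ftor" where
  "comp_ftor G F = \<lparr> fobj = fobj G \<circ> fobj F, farr = farr G \<circ> farr F \<rparr>"

definition is_ftor ::
    "('o, 'm, 'z) cat_scheme \<Rightarrow> ('p, 'n, 'y) cat_scheme \<Rightarrow> ('o, 'm, 'p, 'n) ftor \<Rightarrow> bool" where
  "is_ftor C D F \<longleftrightarrow> category C \<and> category D \<and>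
    (\<forall>A \<in> Obj C. fobj F A \<in> Obj D) \<and>
    (\<forall>f \<in> Arr C. farr F f \<in> hom D (fobj F (Dom C f)) (fobj F (Cod C f))) \<and>
    (\<forall>A \<in> Obj C. farr F (Id C A) = Id D (fobj F A)) \<and>
    (\<forall>f \<in> Arr C. \<forall>g \<in> Arr C. Cod C f = Dom C g \<longrightarrow>
      farr F (Comp C g f) = Comp D (farr F g) (farr F f))"

definition natural_transformation ::
    "('o, 'm, 'z) cat_scheme \<Rightarrow> ('p, 'n, 'y) cat_scheme \<Rightarrow>
     ('o, 'm, 'p, 'n) ftor \<Rightarrow> ('o, 'm, 'p, 'n) ftor \<Rightarrow> ('o \<Rightarrow> 'n) \<Rightarrow> bool" where
  "natural_transformation C D F G \<tau> \<longleftrightarrow> is_ftor C D F \<and> is_ftor C D G \<and>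
    (\<forall>A \<in> Obj C. \<tau> A \<in> hom D (fobj F A) (fobj G A)) \<and>
    (\<forall>f \<in> Arr C. Comp D (farr G f) (\<tau> (Dom C f)) = Comp D (\<tau> (Cod C f)) (farr F f))"

definition natural_isomorphism ::
    "('o, 'm, 'z) cat_scheme \<Rightarrow> ('p, 'n, 'y) cat_scheme \<Rightarrow>
     ('o, 'm, 'p, 'n) ftor \<Rightarrow> ('o, 'm, 'p, 'n) ftor \<Rightarrow> ('o \<Rightarrow> 'n) \<Rightarrow> bool" where
  "natural_isomorphism C D F G \<tau> \<longleftrightarrow>
    natural_transformation C D F G \<tau> \<and> (\<forall>A \<in> Obj C. isomorphism D (\<tau> A))"

section \<open>Finite biproducts and the induced sum of parallel maps\<close>

text \<open>
  Finite biproducts are given by a chosen zero object and a chosen biproduct of each pair of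
  objects.  No enrichment is part of the data: the zero maps and the sum of parallel maps are
  defined from the universal properties.
\<close>

record ('o, 'm) biprod_cat = "('o, 'm) cat" +
  ZeroObj :: "'o"
  Biprod :: "'o \<Rightarrow> 'o \<Rightarrow> 'o" (infixl "\<oplus>\<index>" 65)
  inj1 :: "'o \<Rightarrow> 'o \<Rightarrow> 'm" ("\<iota>\<^sub>1\<index>")
  inj2 :: "'o \<Rightarrow> 'o \<Rightarrow> 'm" ("\<iota>\<^sub>2\<index>")
  proj1 :: "'o \<Rightarrow> 'o \<Rightarrow> 'm" ("\<pi>\<^sub>1\<index>")
  proj2 :: "'o \<Rightarrow> 'o \<Rightarrow> 'm" ("\<pi>\<^sub>2\<index>")

definition zero_map :: "('o, 'm, 'z) biprod_cat_scheme \<Rightarrow> 'o \<Rightarrow> 'o \<Rightarrow> 'm" ("\<zero>\<index>") where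
  "zero_map X A B =
    Comp X (THE g. g \<in> hom X (ZeroObj X) B) (THE f. f \<in> hom X A (ZeroObj X))"

locale finite_biproducts = category X
  for X :: "('o, 'm, 'z) biprod_cat_scheme" (structure) +
  assumes ZeroObj_in_Obj: "ZeroObj X \<in> Obj X"
    and ZeroObj_terminal: "A \<in> Obj X \<Longrightarrow> \<exists>!f. f \<in> hom X A (ZeroObj X)"
    and ZeroObj_initial: "A \<in> Obj X \<Longrightarrow> \<exists>!f. f \<in> hom X (ZeroObj X) A"
    and Biprod_in_Obj: "\<lbrakk>A \<in> Obj X; B \<in> Obj X\<rbrakk> \<Longrightarrow> A \<oplus> B \<in> Obj X"
    and inj1_in_hom: "\<lbrakk>A \<in> Obj X; B \<in> Obj X\<rbrakk> \<Longrightarrow> \<iota>\<^sub>1 A B \<in> hom X A (A \<oplus> B)"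
    and inj2_in_hom: "\<lbrakk>A \<in> Obj X; B \<in> Obj X\<rbrakk> \<Longrightarrow> \<iota>\<^sub>2 A B \<in> hom X B (A \<oplus> B)"
    and proj1_in_hom: "\<lbrakk>A \<in> Obj X; B \<in> Obj X\<rbrakk> \<Longrightarrow> \<pi>\<^sub>1 A B \<in> hom X (A \<oplus> B) A"
    and proj2_in_hom: "\<lbrakk>A \<in> Obj X; B \<in> Obj X\<rbrakk> \<Longrightarrow> \<pi>\<^sub>2 A B \<in> hom X (A \<oplus> B) B"
    and Biprod_product:
      "\<lbrakk>A \<in> Obj X; B \<in> Obj X; f \<in> hom X D A; g \<in> hom X D B\<rbrakk> \<Longrightarrow>
        \<exists>!h. h \<in> hom X D (A \<oplus> B) \<and> \<pi>\<^sub>1 A B \<cdot> h = f \<and> \<pi>\<^sub>2 A B \<cdot> h = g"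
    and Biprod_coproduct:
      "\<lbrakk>A \<in> Obj X; B \<in> Obj X; f \<in> hom X A D; g \<in> hom X B D\<rbrakk> \<Longrightarrow>
        \<exists>!h. h \<in> hom X (A \<oplus> B) D \<and> h \<cdot> \<iota>\<^sub>1 A B = f \<and> h \<cdot> \<iota>\<^sub>2 A B = g"
    and proj1_inj1: "\<lbrakk>A \<in> Obj X; B \<in> Obj X\<rbrakk> \<Longrightarrow> \<pi>\<^sub>1 A B \<cdot> \<iota>\<^sub>1 A B = \<one> A"
    and proj2_inj2: "\<lbrakk>A \<in> Obj X; B \<in> Obj X\<rbrakk> \<Longrightarrow> \<pi>\<^sub>2 A B \<cdot> \<iota>\<^sub>2 A B = \<one> B"
    and proj2_inj1: "\<lbrakk>A \<in> Obj X; B \<in> Obj X\<rbrakk> \<Longrightarrow> \<pi>\<^sub>2 A B \<cdot> \<iota>\<^sub>1 A B = \<zero> A B"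
    and proj1_inj2: "\<lbrakk>A \<in> Obj X; B \<in> Obj X\<rbrakk> \<Longrightarrow> \<pi>\<^sub>1 A B \<cdot> \<iota>\<^sub>2 A B = \<zero> B A"

definition pairing :: "('o, 'm, 'z) biprod_cat_scheme \<Rightarrow> 'm \<Rightarrow> 'm \<Rightarrow> 'm" where
  "pairing X f g =
    (THE h. h \<in> hom X (Dom X f) (Biprod X (Cod X f) (Cod X g)) \<and>
      Comp X (proj1 X (Cod X f) (Cod X g)) h = f \<and>
      Comp X (proj2 X (Cod X f) (Cod X g)) h = g)"

definition copairing :: "('o, 'm, 'z) biprod_cat_scheme \<Rightarrow> 'm \<Rightarrow> 'm \<Rightarrow> 'm" where
  "copairing X f g =
    (THE h. h \<in> hom X (Biprod X (Dom X f) (Dom X g)) (Cod X f) \<and>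
      Comp X h (inj1 X (Dom X f) (Dom X g)) = f \<and>
      Comp X h (inj2 X (Dom X f) (Dom X g)) = g)"

definition biprod_map :: "('o, 'm, 'z) biprod_cat_scheme \<Rightarrow> 'm \<Rightarrow> 'm \<Rightarrow> 'm" where
  "biprod_map X f g =
    pairing X (Comp X f (proj1 X (Dom X f) (Dom X g))) (Comp X g (proj2 X (Dom X f) (Dom X g)))"

text \<open>The sum of \<open>f, g : A \<rightarrow> B\<close> is the codiagonal of \<open>B\<close> after \<open>f \<oplus> g\<close> after the diagonal of \<open>A\<close>.\<close>

definition arr_sum :: "('o, 'm, 'z) biprod_cat_scheme \<Rightarrow> 'm \<Rightarrow> 'm \<Rightarrow> 'm"
    (infixl "\<^bold>+\<index>" 65) where
  "arr_sum X f g =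
    Comp X (copairing X (Id X (Cod X f)) (Id X (Cod X f)))
      (Comp X (biprod_map X f g) (pairing X (Id X (Dom X f)) (Id X (Dom X f))))"

section \<open>Monads, idempotent monads and Hopf monads\<close>

locale monad = category C
  for C :: "('o, 'm, 'z) cat_scheme" (structure) +
  fixes T :: "('o, 'm, 'o, 'm) ftor" and \<mu> :: "'o \<Rightarrow> 'm" and \<eta> :: "'o \<Rightarrow> 'm"
  assumes ftor: "is_ftor C C T"
    and mult_natural: "natural_transformation C C (comp_ftor T T) T \<mu>"
    and unit_natural: "natural_transformation C C id_ftor T \<eta>"
    and mult_assoc: "A \<in> Obj C \<Longrightarrow> \<mu> A \<cdot> farr T (\<mu> A) = \<mu> A \<cdot> \<mu> (fobj T A)"
    and mult_unit_left: "A \<in> Obj C \<Longrightarrow> \<mu> A \<cdot> \<eta> (fobj T A) = \<one> (fobj T A)"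
    and mult_unit_right: "A \<in> Obj C \<Longrightarrow> \<mu> A \<cdot> farr T (\<eta> A) = \<one> (fobj T A)"

definition idempotent_monad ::
    "('o, 'm, 'z) cat_scheme \<Rightarrow> ('o, 'm, 'o, 'm) ftor \<Rightarrow> ('o \<Rightarrow> 'm) \<Rightarrow> ('o \<Rightarrow> 'm) \<Rightarrow> bool" where
  "idempotent_monad C T \<mu> \<eta> \<longleftrightarrow>
    monad C T \<mu> \<eta> \<and> natural_isomorphism C C (comp_ftor T T) T \<mu>"

definition fusion_operator ::
    "('o, 'm, 'z) biprod_cat_scheme \<Rightarrow> ('o, 'm, 'o, 'm) ftor \<Rightarrow> ('o \<Rightarrow> 'm) \<Rightarrow> 'o \<Rightarrow> 'o \<Rightarrow> 'm" where
  "fusion_operator X T \<mu> A B =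
    inj1 X (fobj T A) (fobj T B) \<cdot>\<^bsub>X\<^esub> farr T (proj1 X A (fobj T B)) \<^bold>+\<^bsub>X\<^esub>
    inj2 X (fobj T A) (fobj T B) \<cdot>\<^bsub>X\<^esub> \<mu> B \<cdot>\<^bsub>X\<^esub> farr T (proj2 X A (fobj T B))"

text \<open>The bifunctors \<open>T(- \<oplus> T(-))\<close> and \<open>T(-) \<oplus> T(-)\<close> between which the fusion operator lives.\<close>

definition fusion_source ::
    "('o, 'm, 'z) biprod_cat_scheme \<Rightarrow> ('o, 'm, 'o, 'm) ftor \<Rightarrow> ('o \<times> 'o, 'm \<times> 'm, 'o, 'm) ftor" where
  "fusion_source X T =
    \<lparr> fobj = (\<lambda>(A, B). fobj T (Biprod X A (fobj T B))),
      farr = (\<lambda>(f, g). farr T (biprod_map X f (farr T g))) \<rparr>"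

definition fusion_target ::
    "('o, 'm, 'z) biprod_cat_scheme \<Rightarrow> ('o, 'm, 'o, 'm) ftor \<Rightarrow> ('o \<times> 'o, 'm \<times> 'm, 'o, 'm) ftor" where
  "fusion_target X T =
    \<lparr> fobj = (\<lambda>(A, B). Biprod X (fobj T A) (fobj T B)),
      farr = (\<lambda>(f, g). biprod_map X (farr T f) (farr T g)) \<rparr>"

definition Hopf_monad ::
    "('o, 'm, 'z) biprod_cat_scheme \<Rightarrow> ('o, 'm, 'o, 'm) ftor \<Rightarrow> ('o \<Rightarrow> 'm) \<Rightarrow> ('o \<Rightarrow> 'm) \<Rightarrow> bool" where
  "Hopf_monad X T \<mu> \<eta> \<longleftrightarrow> monad X T \<mu> \<eta> \<and>
    natural_isomorphism (prod_cat X X) X (fusion_source X T) (fusion_target X T)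
      (\<lambda>(A, B). fusion_operator X T \<mu> A B)"

end

theory Submission
  imports Defs
begin

text \<open>
  For an idempotent monad two maps out of \<open>T A\<close> into a free algebra agree as soon as they agree
  after \<open>\<eta> A\<close>; by naturality of the unit, \<open>T 0 \<cdot> \<eta> = \<eta> \<cdot> 0 = 0\<close>, so \<open>T\<close> preserves zero maps.
  Consequently the fusion operator \<open>h\<close> composed with \<open>T (1 \<oplus> 0) + T (0 \<oplus> 1)\<close> is always \<open>h\<close>,
  which gives the equation when \<open>h\<close> is monic.  Conversely,
  \<open>g = T \<iota>\<^sub>1 \<cdot> \<pi>\<^sub>1 + T \<iota>\<^sub>2 \<cdot> \<eta> \<cdot> \<pi>\<^sub>2\<close> always satisfies \<open>h \<cdot> g = 1\<close>, and \<open>g \<cdot> h\<close> is the left-hand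
  side of the equation.
\<close>

section \<open>Typing and rewriting in a category\<close>

lemma in_hom_iff: "f \<in> hom C A B \<longleftrightarrow> f \<in> Arr C \<and> Dom C f = A \<and> Cod C f = B"
  by (simp add: hom_def)

context category
begin

lemmas [simp] = Dom_in_Obj Cod_in_Obj

lemma Id_arr [simp]:
  assumes "A \<in> Obj C"
  shows "\<one> A \<in> Arr C" "Dom C (\<one> A) = A" "Cod C (\<one> A) = A"
  using Id_in_hom[OF assms] by (simp_all add: in_hom_iff)

lemma Comp_arr [simp]:
  assumes "f \<in> Arr C" "g \<in> Arr C" "Cod C f = Dom C g"
  shows "g \<cdot> f \<in> Arr C" "Dom C (g \<cdot> f) = Dom C f" "Cod C (g \<cdot> f) = Cod C g"
  using Comp_in_hom[of f "Dom C f" "Dom C g" g "Cod C g"] assms by (simp_all add: in_hom_iff)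

lemma Comp_Id [simp]:
  assumes "f \<in> Arr C"
  shows "Cod C f = A \<Longrightarrow> \<one> A \<cdot> f = f" "Dom C f = A \<Longrightarrow> f \<cdot> \<one> A = f"
  using Comp_Id_left Comp_Id_right assms by (auto simp: in_hom_iff)

text \<open>As a simp rule this nests every composite to the right. Later rewrite rules therefore
  often come in a second version with a trailing factor \<open>k\<close>.\<close>

lemma Comp_assoc_arr [simp]:
  assumes "f \<in> Arr C" "g \<in> Arr C" "h \<in> Arr C" "Cod C f = Dom C g" "Cod C g = Dom C h"
  shows "h \<cdot> g \<cdot> f = h \<cdot> (g \<cdot> f)"
  using Comp_assoc[of f "Dom C f" "Dom C g" g "Dom C h" h "Cod C h"] assms
  by (simp add: in_hom_iff)

end

text \<open>The fusion operator is natural in two variables, so its naturality is stated over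
  \<open>prod_cat X X\<close>.\<close>

lemma category_prod_cat:
  assumes "category C" "category D"
  shows "category (prod_cat C D)"
proof -
  interpret C: category C by fact
  interpret D: category D by fact
  show ?thesis
    by unfold_locales (auto simp: prod_cat_def in_hom_iff)
qed

section \<open>Zero maps, biproducts and sums of parallel maps\<close>

context finite_biproducts
begin

lemmas [simp] = ZeroObj_in_Obj Biprod_in_Obj

lemma injection_projection_arr [simp]:
  assumes "A \<in> Obj X" "B \<in> Obj X"
  shows "\<iota>\<^sub>1 A B \<in> Arr X" "Dom X (\<iota>\<^sub>1 A B) = A" "Cod X (\<iota>\<^sub>1 A B) = A \<oplus> B"
    and "\<iota>\<^sub>2 A B \<in> Arr X" "Dom X (\<iota>\<^sub>2 A B) = B" "Cod X (\<iota>\<^sub>2 A B) = A \<oplus> B"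
    and "\<pi>\<^sub>1 A B \<in> Arr X" "Dom X (\<pi>\<^sub>1 A B) = A \<oplus> B" "Cod X (\<pi>\<^sub>1 A B) = A"
    and "\<pi>\<^sub>2 A B \<in> Arr X" "Dom X (\<pi>\<^sub>2 A B) = A \<oplus> B" "Cod X (\<pi>\<^sub>2 A B) = B"
  using inj1_in_hom[OF assms] inj2_in_hom[OF assms] proj1_in_hom[OF assms] proj2_in_hom[OF assms]
  by (simp_all add: in_hom_iff)

lemma zero_map_arr [simp]:
  assumes "A \<in> Obj X" "B \<in> Obj X"
  shows "\<zero> A B \<in> Arr X" "Dom X (\<zero> A B) = A" "Cod X (\<zero> A B) = B"
  using theI'[OF ZeroObj_terminal[OF assms(1)]] theI'[OF ZeroObj_initial[OF assms(2)]]
  by (simp_all add: zero_map_def in_hom_iff)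

text \<open>Uniqueness of maps into and out of the zero object lets the definite descriptions in
  \<open>zero_map\<close> be replaced by arbitrary witnesses.\<close>

lemma zero_map_eq:
  assumes "f \<in> hom X A (ZeroObj X)" "g \<in> hom X (ZeroObj X) B"
  shows "\<zero> A B = g \<cdot> f"
proof -
  have "A \<in> Obj X" "B \<in> Obj X"
    using assms by (auto simp: in_hom_iff)
  then have "(THE f. f \<in> hom X A (ZeroObj X)) = f" "(THE g. g \<in> hom X (ZeroObj X) B) = g"
    using assms by (auto intro!: the1_equality ZeroObj_terminal ZeroObj_initial)
  then show ?thesis
    by (simp add: zero_map_def)
qed

text \<open>A map into the zero object precomposed with \<open>f\<close> is again a map into the
  zero object, so the composite still has the factorization required by
  \<open>zero_map_eq\<close>.\<close>

lemma zero_map_Comp [simp]: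
  assumes "f \<in> Arr X" "Cod X f = A" "B \<in> Obj X"
  shows "\<zero> A B \<cdot> f = \<zero> (Dom X f) B"
proof -
  have A: "A \<in> Obj X"
    using assms by auto
  obtain t where t: "t \<in> hom X A (ZeroObj X)"
    using ZeroObj_terminal[OF A] by auto
  obtain i where i: "i \<in> hom X (ZeroObj X) B"
    using ZeroObj_initial[OF assms(3)] by auto
  have "t \<cdot> f \<in> hom X (Dom X f) (ZeroObj X)"
    using t assms by (simp add: in_hom_iff)
  from zero_map_eq[OF this i] show ?thesis
    using zero_map_eq[OF t i] t i assms by (simp add: in_hom_iff)
qed

lemma Comp_zero_map [simp]:
  assumes "f \<in> Arr X" "Dom X f = B" "A \<in> Obj X"
  shows "f \<cdot> \<zero> A B = \<zero> A (Cod X f)"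
proof -
  have B: "B \<in> Obj X"
    using assms by auto
  obtain t where t: "t \<in> hom X A (ZeroObj X)"
    using ZeroObj_terminal[OF assms(3)] by auto
  obtain i where i: "i \<in> hom X (ZeroObj X) B"
    using ZeroObj_initial[OF B] by auto
  have "f \<cdot> i \<in> hom X (ZeroObj X) (Cod X f)"
    using i assms by (simp add: in_hom_iff)
  from zero_map_eq[OF t this] show ?thesis
    using zero_map_eq[OF t i] t i assms by (simp add: in_hom_iff)
qed

lemmas [simp] = proj1_inj1 proj2_inj2 proj2_inj1 proj1_inj2

lemma projection_injection_Comp [simp]:
  assumes "A \<in> Obj X" "B \<in> Obj X" "f \<in> Arr X"
  shows "Cod X f = A \<Longrightarrow> \<pi>\<^sub>1 A B \<cdot> (\<iota>\<^sub>1 A B \<cdot> f) = f"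
    and "Cod X f = A \<Longrightarrow> \<pi>\<^sub>2 A B \<cdot> (\<iota>\<^sub>1 A B \<cdot> f) = \<zero> (Dom X f) B"
    and "Cod X f = B \<Longrightarrow> \<pi>\<^sub>1 A B \<cdot> (\<iota>\<^sub>2 A B \<cdot> f) = \<zero> (Dom X f) A"
    and "Cod X f = B \<Longrightarrow> \<pi>\<^sub>2 A B \<cdot> (\<iota>\<^sub>2 A B \<cdot> f) = f"
  using assms by (simp_all flip: Comp_assoc_arr)

text \<open>The uniqueness half of the product property. Most equations between maps into a
  biproduct are reduced by it to their two components.\<close>

lemma projections_jointly_monic:
  assumes "h \<in> Arr X" "k \<in> Arr X" "Dom X h = Dom X k"
    and "Cod X h = A \<oplus> B" "Cod X k = A \<oplus> B" "A \<in> Obj X" "B \<in> Obj X"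
    and "\<pi>\<^sub>1 A B \<cdot> h = \<pi>\<^sub>1 A B \<cdot> k" "\<pi>\<^sub>2 A B \<cdot> h = \<pi>\<^sub>2 A B \<cdot> k"
  shows "h = k"
proof -
  have "\<pi>\<^sub>1 A B \<cdot> k \<in> hom X (Dom X k) A" "\<pi>\<^sub>2 A B \<cdot> k \<in> hom X (Dom X k) B"
    using assms by (simp_all add: in_hom_iff)
  from Biprod_product[OF assms(6,7) this] show ?thesis
    using assms unfolding in_hom_iff by blast
qed

lemma injections_jointly_epic:
  assumes "h \<in> Arr X" "k \<in> Arr X" "Cod X h = Cod X k"
    and "Dom X h = A \<oplus> B" "Dom X k = A \<oplus> B" "A \<in> Obj X" "B \<in> Obj X"
    and "h \<cdot> \<iota>\<^sub>1 A B = k \<cdot> \<iota>\<^sub>1 A B" "h \<cdot> \<iota>\<^sub>2 A B = k \<cdot> \<iota>\<^sub>2 A B"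
  shows "h = k"
proof -
  have "k \<cdot> \<iota>\<^sub>1 A B \<in> hom X A (Cod X k)" "k \<cdot> \<iota>\<^sub>2 A B \<in> hom X B (Cod X k)"
    using assms by (simp_all add: in_hom_iff)
  from Biprod_coproduct[OF assms(6,7) this] show ?thesis
    using assms unfolding in_hom_iff by blast
qed

text \<open>The only place where the definite description behind \<open>pairing\<close> is unfolded;
  existence and uniqueness come from \<open>Biprod_product\<close>.\<close>

lemma pairing_arr [simp]:
  assumes "f \<in> Arr X" "g \<in> Arr X" "Dom X f = Dom X g"
  shows "pairing X f g \<in> Arr X" "Dom X (pairing X f g) = Dom X g"
    and "Cod X (pairing X f g) = Cod X f \<oplus> Cod X g"
    and "Cod X f = A \<Longrightarrow> Cod X g = B \<Longrightarrow> \<pi>\<^sub>1 A B \<cdot> pairing X f g = f"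
    and "Cod X f = A \<Longrightarrow> Cod X g = B \<Longrightarrow> \<pi>\<^sub>2 A B \<cdot> pairing X f g = g"
proof -
  have "f \<in> hom X (Dom X f) (Cod X f)" "g \<in> hom X (Dom X f) (Cod X g)"
    using assms by (simp_all add: in_hom_iff)
  from theI'[OF Biprod_product[OF Cod_in_Obj[OF assms(1)] Cod_in_Obj[OF assms(2)] this]]
  show "pairing X f g \<in> Arr X" "Dom X (pairing X f g) = Dom X g"
    and "Cod X (pairing X f g) = Cod X f \<oplus> Cod X g"
    and "Cod X f = A \<Longrightarrow> Cod X g = B \<Longrightarrow> \<pi>\<^sub>1 A B \<cdot> pairing X f g = f"
    and "Cod X f = A \<Longrightarrow> Cod X g = B \<Longrightarrow> \<pi>\<^sub>2 A B \<cdot> pairing X f g = g"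
    using assms(3) by (simp_all add: pairing_def in_hom_iff)
qed

lemma projection_pairing_Comp [simp]:
  assumes "f \<in> Arr X" "g \<in> Arr X" "Dom X f = Dom X g" "Cod X f = A" "Cod X g = B"
    and "k \<in> Arr X" "Cod X k = Dom X g"
  shows "\<pi>\<^sub>1 A B \<cdot> (pairing X f g \<cdot> k) = f \<cdot> k" "\<pi>\<^sub>2 A B \<cdot> (pairing X f g \<cdot> k) = g \<cdot> k"
  using assms by (auto simp flip: Comp_assoc_arr)

lemma copairing_arr [simp]:
  assumes "f \<in> Arr X" "g \<in> Arr X" "Cod X f = Cod X g"
  shows "copairing X f g \<in> Arr X" "Dom X (copairing X f g) = Dom X f \<oplus> Dom X g"
    and "Cod X (copairing X f g) = Cod X g"
    and "Dom X f = A \<Longrightarrow> Dom X g = B \<Longrightarrow> copairing X f g \<cdot> \<iota>\<^sub>1 A B = f"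
    and "Dom X f = A \<Longrightarrow> Dom X g = B \<Longrightarrow> copairing X f g \<cdot> \<iota>\<^sub>2 A B = g"
proof -
  have "f \<in> hom X (Dom X f) (Cod X f)" "g \<in> hom X (Dom X g) (Cod X f)"
    using assms by (simp_all add: in_hom_iff)
  from theI'[OF Biprod_coproduct[OF Dom_in_Obj[OF assms(1)] Dom_in_Obj[OF assms(2)] this]]
  show "copairing X f g \<in> Arr X" "Dom X (copairing X f g) = Dom X f \<oplus> Dom X g"
    and "Cod X (copairing X f g) = Cod X g"
    and "Dom X f = A \<Longrightarrow> Dom X g = B \<Longrightarrow> copairing X f g \<cdot> \<iota>\<^sub>1 A B = f"
    and "Dom X f = A \<Longrightarrow> Dom X g = B \<Longrightarrow> copairing X f g \<cdot> \<iota>\<^sub>2 A B = g"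
    using assms(3) by (simp_all add: copairing_def in_hom_iff)
qed

lemma copairing_injection_Comp [simp]:
  assumes "f \<in> Arr X" "g \<in> Arr X" "Cod X f = Cod X g" "Dom X f = A" "Dom X g = B" "k \<in> Arr X"
  shows "Cod X k = A \<Longrightarrow> copairing X f g \<cdot> (\<iota>\<^sub>1 A B \<cdot> k) = f \<cdot> k"
    and "Cod X k = B \<Longrightarrow> copairing X f g \<cdot> (\<iota>\<^sub>2 A B \<cdot> k) = g \<cdot> k"
  using assms by (auto simp flip: Comp_assoc_arr)

lemma biprod_map_arr [simp]:
  assumes "f \<in> Arr X" "g \<in> Arr X"
  shows "biprod_map X f g \<in> Arr X"
    and "Dom X (biprod_map X f g) = Dom X f \<oplus> Dom X g"
    and "Cod X (biprod_map X f g) = Cod X f \<oplus> Cod X g"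
    and "Cod X f = A \<Longrightarrow> Cod X g = B \<Longrightarrow>
      \<pi>\<^sub>1 A B \<cdot> biprod_map X f g = f \<cdot> \<pi>\<^sub>1 (Dom X f) (Dom X g)"
    and "Cod X f = A \<Longrightarrow> Cod X g = B \<Longrightarrow>
      \<pi>\<^sub>2 A B \<cdot> biprod_map X f g = g \<cdot> \<pi>\<^sub>2 (Dom X f) (Dom X g)"
  using assms by (simp_all add: biprod_map_def)

lemma projection_biprod_map_Comp [simp]:
  assumes "f \<in> Arr X" "g \<in> Arr X" "Cod X f = A" "Cod X g = B"
    and "k \<in> Arr X" "Cod X k = Dom X f \<oplus> Dom X g"
  shows "\<pi>\<^sub>1 A B \<cdot> (biprod_map X f g \<cdot> k) = f \<cdot> (\<pi>\<^sub>1 (Dom X f) (Dom X g) \<cdot> k)"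
    and "\<pi>\<^sub>2 A B \<cdot> (biprod_map X f g \<cdot> k) = g \<cdot> (\<pi>\<^sub>2 (Dom X f) (Dom X g) \<cdot> k)"
  using assms by (simp_all add: biprod_map_def)

text \<open>Together with \<open>biprod_map_Comp\<close> this is bifunctoriality of the biproduct,
  from which the source and target of the fusion operator inherit functoriality.\<close>

lemma biprod_map_Id:
  assumes "A \<in> Obj X" "B \<in> Obj X"
  shows "biprod_map X (\<one> A) (\<one> B) = \<one> (A \<oplus> B)"
  by (rule projections_jointly_monic[where A = A and B = B]) (use assms in simp_all)

lemma biprod_map_Comp:
  assumes "f \<in> Arr X" "g \<in> Arr X" "f' \<in> Arr X" "g' \<in> Arr X"
    and "Cod X f = Dom X f'" "Cod X g = Dom X g'"
  shows "biprod_map X (f' \<cdot> f) (g' \<cdot> g) = biprod_map X f' g' \<cdot> biprod_map X f g"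
  by (rule projections_jointly_monic[where A = "Cod X f'" and B = "Cod X g'"])
    (use assms in simp_all)

text \<open>Absorbing the diagonal into the pairing leaves two factors: precomposition then affects
  only the pairing, and postcomposition only has to pass the codiagonal.\<close>

lemma arr_sum_eq_copairing_pairing:
  assumes "f \<in> Arr X" "g \<in> Arr X" "Dom X f = Dom X g" "Cod X f = Cod X g"
  shows "f \<^bold>+ g = copairing X (\<one> (Cod X g)) (\<one> (Cod X g)) \<cdot> pairing X f g"
proof -
  have "biprod_map X f g \<cdot> pairing X (\<one> (Dom X g)) (\<one> (Dom X g)) = pairing X f g"
    by (rule projections_jointly_monic[where A = "Cod X f" and B = "Cod X g"])
      (use assms in simp_all)
  then show ?thesis
    using assms by (simp add: arr_sum_def)
qed

lemma arr_sum_arr [simp]: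
  assumes "f \<in> Arr X" "g \<in> Arr X" "Dom X f = Dom X g" "Cod X f = Cod X g"
  shows "f \<^bold>+ g \<in> Arr X" "Dom X (f \<^bold>+ g) = Dom X g" "Cod X (f \<^bold>+ g) = Cod X g"
  using assms by (simp_all add: arr_sum_eq_copairing_pairing)

lemma arr_sum_Comp:
  assumes "f \<in> Arr X" "g \<in> Arr X" "Dom X f = Dom X g" "Cod X f = Cod X g"
    and "k \<in> Arr X" "Cod X k = Dom X g"
  shows "(f \<^bold>+ g) \<cdot> k = f \<cdot> k \<^bold>+ g \<cdot> k"
proof -
  have "pairing X f g \<cdot> k = pairing X (f \<cdot> k) (g \<cdot> k)"
    by (rule projections_jointly_monic[where A = "Cod X f" and B = "Cod X g"])
      (use assms in simp_all)
  then show ?thesis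
    using assms by (simp add: arr_sum_eq_copairing_pairing)
qed

text \<open>The codiagonal is natural: \<open>k\<close> after the codiagonal equals the codiagonal
  after \<open>biprod_map X k k\<close>.\<close>

lemma Comp_arr_sum:
  assumes "f \<in> Arr X" "g \<in> Arr X" "Dom X f = Dom X g" "Cod X f = Cod X g"
    and "k \<in> Arr X" "Dom X k = Cod X g"
  shows "k \<cdot> (f \<^bold>+ g) = k \<cdot> f \<^bold>+ k \<cdot> g"
proof -
  let ?B = "Cod X g" and ?D = "Cod X k"
  let ?fold = "\<lambda>B. copairing X (\<one> B) (\<one> B)"
  \<comment> \<open>\<open>biprod_map\<close> is defined through projections, so its effect on the
    injections has to be computed componentwise before testing on injections below.\<close>
  have inj: "biprod_map X k k \<cdot> \<iota>\<^sub>1 ?B ?B = \<iota>\<^sub>1 ?D ?D \<cdot> k"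
    "biprod_map X k k \<cdot> \<iota>\<^sub>2 ?B ?B = \<iota>\<^sub>2 ?D ?D \<cdot> k"
    by (rule projections_jointly_monic[where A = ?D and B = ?D]; use assms in simp)+
  have fold: "k \<cdot> ?fold ?B = ?fold ?D \<cdot> biprod_map X k k"
    by (rule injections_jointly_epic[where A = ?B and B = ?B]) (use assms inj in simp_all)
  have "biprod_map X k k \<cdot> pairing X f g = pairing X (k \<cdot> f) (k \<cdot> g)"
    by (rule projections_jointly_monic[where A = ?D and B = ?D]) (use assms in simp_all)
  moreover have "k \<cdot> (?fold ?B \<cdot> pairing X f g) = ?fold ?D \<cdot> (biprod_map X k k \<cdot> pairing X f g)"
    using fold assms by (simp flip: Comp_assoc_arr)
  ultimately show ?thesis
    using assms by (simp add: arr_sum_eq_copairing_pairing)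
qed

text \<open>Pairing with a zero map is the same as following by an injection, and the codiagonal
  cancels that injection.\<close>

lemma arr_sum_zero_map [simp]:
  assumes "f \<in> Arr X" "Dom X f = A" "Cod X f = B"
  shows "f \<^bold>+ \<zero> A B = f" "\<zero> A B \<^bold>+ f = f"
proof -
  have obj: "A \<in> Obj X" "B \<in> Obj X"
    using assms by auto
  have "pairing X f (\<zero> A B) = \<iota>\<^sub>1 B B \<cdot> f" "pairing X (\<zero> A B) f = \<iota>\<^sub>2 B B \<cdot> f"
    by (rule projections_jointly_monic[where A = B and B = B]; use assms obj in simp)+
  then show "f \<^bold>+ \<zero> A B = f" "\<zero> A B \<^bold>+ f = f"
    using assms obj by (simp_all add: arr_sum_eq_copairing_pairing)
qed

end

section \<open>The fusion operator of a monad and its naturality\<close>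

locale biproduct_monad = finite_biproducts X + monad X T \<mu> \<eta>
  for X :: "('o, 'm, 'z) biprod_cat_scheme" (structure)
    and T :: "('o, 'm, 'o, 'm) ftor" and \<mu> \<eta> :: "'o \<Rightarrow> 'm"
begin

lemma ftor_arr [simp]:
  shows "A \<in> Obj X \<Longrightarrow> fobj T A \<in> Obj X"
    and "A \<in> Obj X \<Longrightarrow> farr T (\<one> A) = \<one> (fobj T A)"
    and "f \<in> Arr X \<Longrightarrow> farr T f \<in> Arr X"
    and "f \<in> Arr X \<Longrightarrow> Dom X (farr T f) = fobj T (Dom X f)"
    and "f \<in> Arr X \<Longrightarrow> Cod X (farr T f) = fobj T (Cod X f)"
  using ftor by (auto simp: is_ftor_def in_hom_iff)

lemma ftor_Comp:
  assumes "f \<in> Arr X" "g \<in> Arr X" "Cod X f = Dom X g"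
  shows "farr T (g \<cdot> f) = farr T g \<cdot> farr T f"
  using ftor assms by (auto simp: is_ftor_def)

lemma mult_arr [simp]:
  assumes "A \<in> Obj X"
  shows "\<mu> A \<in> Arr X" "Dom X (\<mu> A) = fobj T (fobj T A)" "Cod X (\<mu> A) = fobj T A"
  using mult_natural assms by (auto simp: natural_transformation_def in_hom_iff comp_ftor_def)

lemma unit_arr [simp]:
  assumes "A \<in> Obj X"
  shows "\<eta> A \<in> Arr X" "Dom X (\<eta> A) = A" "Cod X (\<eta> A) = fobj T A"
  using unit_natural assms by (auto simp: natural_transformation_def in_hom_iff id_ftor_def)

lemma mult_naturality:
  "f \<in> Arr X \<Longrightarrow> farr T f \<cdot> \<mu> (Dom X f) = \<mu> (Cod X f) \<cdot> farr T (farr T f)"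
  using mult_natural by (auto simp: natural_transformation_def comp_ftor_def)

lemma unit_naturality: "f \<in> Arr X \<Longrightarrow> farr T f \<cdot> \<eta> (Dom X f) = \<eta> (Cod X f) \<cdot> f"
  using unit_natural by (auto simp: natural_transformation_def id_ftor_def)

lemma fusion_operator_arr [simp]:
  assumes "A \<in> Obj X" "B \<in> Obj X"
  shows "fusion_operator X T \<mu> A B \<in> Arr X"
    and "Dom X (fusion_operator X T \<mu> A B) = fobj T (A \<oplus> fobj T B)"
    and "Cod X (fusion_operator X T \<mu> A B) = fobj T A \<oplus> fobj T B"
  using assms by (simp_all add: fusion_operator_def)

text \<open>Each projection keeps one summand and turns the other into a zero map. These two
  components are the form in which the fusion operator is used from here on.\<close>

lemma projection_fusion_operator:
  assumes "A \<in> Obj X" "B \<in> Obj X"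
  shows "\<pi>\<^sub>1 (fobj T A) (fobj T B) \<cdot> fusion_operator X T \<mu> A B = farr T (\<pi>\<^sub>1 A (fobj T B))"
    and "\<pi>\<^sub>2 (fobj T A) (fobj T B) \<cdot> fusion_operator X T \<mu> A B = \<mu> B \<cdot> farr T (\<pi>\<^sub>2 A (fobj T B))"
  using assms by (simp_all add: fusion_operator_def Comp_arr_sum)

lemma projection_fusion_operator_Comp:
  assumes "A \<in> Obj X" "B \<in> Obj X" "k \<in> Arr X" "Cod X k = fobj T (A \<oplus> fobj T B)"
  shows "\<pi>\<^sub>1 (fobj T A) (fobj T B) \<cdot> (fusion_operator X T \<mu> A B \<cdot> k) = farr T (\<pi>\<^sub>1 A (fobj T B)) \<cdot> k"
    and "\<pi>\<^sub>2 (fobj T A) (fobj T B) \<cdot> (fusion_operator X T \<mu> A B \<cdot> k) =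
      \<mu> B \<cdot> (farr T (\<pi>\<^sub>2 A (fobj T B)) \<cdot> k)"
  using projection_fusion_operator[OF assms(1,2)] assms
    Comp_assoc_arr[of k "fusion_operator X T \<mu> A B" "\<pi>\<^sub>1 (fobj T A) (fobj T B)"]
    Comp_assoc_arr[of k "fusion_operator X T \<mu> A B" "\<pi>\<^sub>2 (fobj T A) (fobj T B)"]
  by simp_all

lemma is_ftor_fusion_source: "is_ftor (prod_cat X X) X (fusion_source X T)"
  using category_prod_cat[OF category_axioms category_axioms] category_axioms
  by (auto simp: is_ftor_def prod_cat_def fusion_source_def in_hom_iff biprod_map_Id
      biprod_map_Comp ftor_Comp)

lemma is_ftor_fusion_target: "is_ftor (prod_cat X X) X (fusion_target X T)"
  using category_prod_cat[OF category_axioms category_axioms] category_axioms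
  by (auto simp: is_ftor_def prod_cat_def fusion_target_def in_hom_iff biprod_map_Id
      biprod_map_Comp ftor_Comp)

lemma fusion_operator_naturality:
  assumes "f \<in> Arr X" "g \<in> Arr X"
  shows "biprod_map X (farr T f) (farr T g) \<cdot> fusion_operator X T \<mu> (Dom X f) (Dom X g) =
    fusion_operator X T \<mu> (Cod X f) (Cod X g) \<cdot> farr T (biprod_map X f (farr T g))"
proof (rule projections_jointly_monic[where A = "fobj T (Cod X f)" and B = "fobj T (Cod X g)"])
  let ?A = "Dom X f" and ?B = "Dom X g"
  \<comment> \<open>The second component is naturality of \<mu> at \<open>g\<close>, precomposed
    with the image of the projection under \<open>T\<close>.\<close>
  have "farr T g \<cdot> (\<mu> ?B \<cdot> farr T (\<pi>\<^sub>2 ?A (fobj T ?B))) =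
      \<mu> (Cod X g) \<cdot> (farr T (farr T g) \<cdot> farr T (\<pi>\<^sub>2 ?A (fobj T ?B)))"
    using assms mult_naturality[OF assms(2)] by (simp flip: Comp_assoc_arr)
  then show "\<pi>\<^sub>2 (fobj T (Cod X f)) (fobj T (Cod X g)) \<cdot>
      (biprod_map X (farr T f) (farr T g) \<cdot> fusion_operator X T \<mu> ?A ?B) =
    \<pi>\<^sub>2 (fobj T (Cod X f)) (fobj T (Cod X g)) \<cdot>
      (fusion_operator X T \<mu> (Cod X f) (Cod X g) \<cdot> farr T (biprod_map X f (farr T g)))"
    using assms
    by (simp add: projection_fusion_operator projection_fusion_operator_Comp flip: ftor_Comp)
qed (use assms in \<open>simp_all add: projection_fusion_operator projection_fusion_operator_Comp
    flip: ftor_Comp\<close>)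

lemma natural_transformation_fusion_operator:
  "natural_transformation (prod_cat X X) X (fusion_source X T) (fusion_target X T)
    (\<lambda>(A, B). fusion_operator X T \<mu> A B)"
  using is_ftor_fusion_source is_ftor_fusion_target fusion_operator_naturality
  by (auto simp: natural_transformation_def prod_cat_def fusion_source_def fusion_target_def
      in_hom_iff)

text \<open>Naturality of the fusion operator is automatic, so the Hopf condition reduces to
  invertibility at each pair of objects.\<close>

lemma Hopf_monad_iff:
  "Hopf_monad X T \<mu> \<eta> \<longleftrightarrow>
    (\<forall>A \<in> Obj X. \<forall>B \<in> Obj X. isomorphism X (fusion_operator X T \<mu> A B))"
  using natural_transformation_fusion_operator
  by (auto simp: Hopf_monad_def natural_isomorphism_def monad_axioms prod_cat_def)

end

section \<open>Idempotent monads and the invertibility criterion\<close>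

locale idempotent_biproduct_monad = biproduct_monad +
  assumes isomorphism_mult: "A \<in> Obj X \<Longrightarrow> isomorphism X (\<mu> A)"
begin

text \<open>A right inverse of an invertible map equals its inverse \<open>g\<close>, since
  \<open>k\<close> and \<open>g\<close> are both equal to
  \<open>g \<cdot> (\<mu> A \<cdot> k)\<close>.\<close>

lemma left_inverse_mult:
  assumes "A \<in> Obj X" "k \<in> Arr X" "Dom X k = fobj T A" "Cod X k = fobj T (fobj T A)"
    and "\<mu> A \<cdot> k = \<one> (fobj T A)"
  shows "k \<cdot> \<mu> A = \<one> (fobj T (fobj T A))"
proof -
  obtain g where g: "g \<in> hom X (fobj T A) (fobj T (fobj T A))"
    and gm: "g \<cdot> \<mu> A = \<one> (fobj T (fobj T A))"
    using isomorphism_mult[OF assms(1)] assms(1) by (auto simp: isomorphism_def)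
  have "g = g \<cdot> (\<mu> A \<cdot> k)"
    using g assms by (simp add: in_hom_iff)
  also have "\<dots> = k"
    using g gm assms Comp_assoc_arr[of k "\<mu> A" g] by (simp add: in_hom_iff)
  finally show ?thesis
    using gm by simp
qed

lemma unit_ftor_mult:
  assumes "A \<in> Obj X"
  shows "\<eta> (fobj T A) \<cdot> \<mu> A = \<one> (fobj T (fobj T A))"
  by (rule left_inverse_mult) (use assms mult_unit_left in simp_all)

text \<open>Both sides are right inverses of the invertible map \<open>\<mu> A\<close>, hence
  equal.\<close>

lemma ftor_unit_eq_unit_ftor:
  assumes "A \<in> Obj X"
  shows "farr T (\<eta> A) = \<eta> (fobj T A)"
proof -
  have "farr T (\<eta> A) = (\<eta> (fobj T A) \<cdot> \<mu> A) \<cdot> farr T (\<eta> A)"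
    unfolding unit_ftor_mult[OF assms] using assms by simp
  also have "\<dots> = \<eta> (fobj T A)"
    using assms mult_unit_right[OF assms] by simp
  finally show ?thesis .
qed

text \<open>Every \<open>k\<close> from \<open>fobj T A\<close> to \<open>fobj T B\<close> is
  recovered from \<open>k \<cdot> \<eta> A\<close> by applying \<open>T\<close> and then
  \<open>\<mu> B\<close>. For a general monad this recovery is available for algebra morphisms;
  idempotency extends it to all maps between free algebras.\<close>

lemma unit_Comp_cancel:
  assumes "f \<in> Arr X" "g \<in> Arr X" "A \<in> Obj X" "B \<in> Obj X"
    and "Dom X f = fobj T A" "Cod X f = fobj T B" "Dom X g = fobj T A" "Cod X g = fobj T B"
    and "f \<cdot> \<eta> A = g \<cdot> \<eta> A"
  shows "f = g"
proof -
  have recover: "\<mu> B \<cdot> farr T (k \<cdot> \<eta> A) = k"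
    if "k \<in> Arr X" "Dom X k = fobj T A" "Cod X k = fobj T B" for k
  proof -
    \<comment> \<open>Idempotency enters here: replacing \<open>farr T (\<eta> A)\<close> by
      \<open>\<eta> (fobj T A)\<close> makes naturality of the unit at \<open>k\<close>
      applicable.\<close>
    have "\<mu> B \<cdot> farr T (k \<cdot> \<eta> A) = \<mu> B \<cdot> (farr T k \<cdot> \<eta> (fobj T A))"
      using that assms(3,4) by (simp add: ftor_Comp ftor_unit_eq_unit_ftor)
    also have "\<dots> = (\<mu> B \<cdot> \<eta> (fobj T B)) \<cdot> k"
      using that assms(3,4) unit_naturality[OF that(1)] by simp
    finally show ?thesis
      using that assms(3,4) mult_unit_left by simp
  qed
  show ?thesis
    using recover[of f] recover[of g] assms by metis
qed

text \<open>After \<open>\<eta> A\<close> both sides become the zero map from \<open>A\<close> to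
  \<open>fobj T B\<close>, the left one by naturality of the unit.\<close>

lemma ftor_zero_map:
  assumes "A \<in> Obj X" "B \<in> Obj X"
  shows "farr T (\<zero> A B) = \<zero> (fobj T A) (fobj T B)"
  by (rule unit_Comp_cancel[where A = A and B = B])
    (use assms unit_naturality[of "\<zero> A B"] in simp_all)

text \<open>Functoriality together with preservation of zero maps: \<open>T\<close> carries the
  projection-injection identities of a biproduct to those of the images.\<close>

lemma ftor_projection_injection [simp]:
  assumes "A \<in> Obj X" "B \<in> Obj X"
  shows "farr T (\<pi>\<^sub>1 A B) \<cdot> farr T (\<iota>\<^sub>1 A B) = \<one> (fobj T A)"
    and "farr T (\<pi>\<^sub>2 A B) \<cdot> farr T (\<iota>\<^sub>2 A B) = \<one> (fobj T B)"
    and "farr T (\<pi>\<^sub>1 A B) \<cdot> farr T (\<iota>\<^sub>2 A B) = \<zero> (fobj T B) (fobj T A)"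
    and "farr T (\<pi>\<^sub>2 A B) \<cdot> farr T (\<iota>\<^sub>1 A B) = \<zero> (fobj T A) (fobj T B)"
  using assms by (simp_all add: ftor_zero_map flip: ftor_Comp)

lemma ftor_projection_injection_Comp [simp]:
  assumes "A \<in> Obj X" "B \<in> Obj X" "k \<in> Arr X"
  shows "Cod X k = fobj T A \<Longrightarrow> farr T (\<pi>\<^sub>1 A B) \<cdot> (farr T (\<iota>\<^sub>1 A B) \<cdot> k) = k"
    and "Cod X k = fobj T B \<Longrightarrow> farr T (\<pi>\<^sub>2 A B) \<cdot> (farr T (\<iota>\<^sub>2 A B) \<cdot> k) = k"
    and "Cod X k = fobj T B \<Longrightarrow>
      farr T (\<pi>\<^sub>1 A B) \<cdot> (farr T (\<iota>\<^sub>2 A B) \<cdot> k) = \<zero> (Dom X k) (fobj T A)"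
    and "Cod X k = fobj T A \<Longrightarrow>
      farr T (\<pi>\<^sub>2 A B) \<cdot> (farr T (\<iota>\<^sub>1 A B) \<cdot> k) = \<zero> (Dom X k) (fobj T B)"
  using assms by (simp_all flip: Comp_assoc_arr)

text \<open>The right-hand side is the one identity still missing for \<open>T\<close> to carry the
  biproduct of \<open>A\<close> and \<open>fobj T B\<close> to a biproduct. The fusion operator is
  the resulting comparison map, with \<mu> identifying \<open>fobj T (fobj T B)\<close> with
  \<open>fobj T B\<close>.\<close>

lemma fusion_operator_isomorphism_iff:
  assumes A: "A \<in> Obj X" and B: "B \<in> Obj X"
  shows "isomorphism X (fusion_operator X T \<mu> A B) \<longleftrightarrow>
    farr T (\<iota>\<^sub>1 A (fobj T B) \<cdot> \<pi>\<^sub>1 A (fobj T B)) \<^bold>+ farr T (\<iota>\<^sub>2 A (fobj T B) \<cdot> \<pi>\<^sub>2 A (fobj T B))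
      = \<one> (fobj T (A \<oplus> fobj T B))"
    (is "isomorphism X ?h \<longleftrightarrow> ?s = \<one> ?S")
proof
  let ?P = "fobj T A \<oplus> fobj T B"
  note simps = A B ftor_Comp Comp_arr_sum projection_fusion_operator projection_fusion_operator_Comp
  assume "isomorphism X ?h"
  then obtain g where g: "g \<in> hom X ?P ?S" and gh: "g \<cdot> ?h = \<one> ?S"
    using A B by (auto simp: isomorphism_def)
  \<comment> \<open>Under either component of \<open>?h\<close> one summand of \<open>?s\<close> is
    absorbed and the other vanishes, by \<open>ftor_projection_injection\<close>.\<close>
  have hs: "?h \<cdot> ?s = ?h"
    by (rule projections_jointly_monic[where A = "fobj T A" and B = "fobj T B"])
      (simp_all add: simps)
  have s: "?s \<in> Arr X" "Dom X ?s = ?S" "Cod X ?s = ?S"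
    using A B by simp_all
  \<comment> \<open>The left inverse \<open>g\<close> cancels \<open>?h\<close> from
    \<open>hs\<close>.\<close>
  have "?s = g \<cdot> ?h \<cdot> ?s"
    unfolding gh using s by simp
  also have "\<dots> = g \<cdot> (?h \<cdot> ?s)"
    by (rule Comp_assoc_arr) (use s g A B in \<open>simp_all add: in_hom_iff\<close>)
  finally show "?s = \<one> ?S"
    using hs gh by simp
next
  let ?P = "fobj T A \<oplus> fobj T B"
  let ?\<pi>\<^sub>1 = "\<pi>\<^sub>1 (fobj T A) (fobj T B)" and ?\<pi>\<^sub>2 = "\<pi>\<^sub>2 (fobj T A) (fobj T B)"
  let ?g\<^sub>1 = "farr T (\<iota>\<^sub>1 A (fobj T B)) \<cdot> ?\<pi>\<^sub>1"
  \<comment> \<open>The factor \<eta> undoes the \<mu> in the second component of the fusion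
    operator.\<close>
  let ?g\<^sub>2 = "farr T (\<iota>\<^sub>2 A (fobj T B)) \<cdot> (\<eta> (fobj T B) \<cdot> ?\<pi>\<^sub>2)"
  let ?g = "?g\<^sub>1 \<^bold>+ ?g\<^sub>2"
  have unit: "\<mu> B \<cdot> (\<eta> (fobj T B) \<cdot> k) = k" if "k \<in> Arr X" "Cod X k = fobj T B" for k
    using Comp_assoc_arr[of k "\<eta> (fobj T B)" "\<mu> B"] that B by (simp add: mult_unit_left)
  \<comment> \<open>Unlike the preceding cancellation, which is a monad law, this one comes from
    idempotency.\<close>
  have mult: "\<eta> (fobj T B) \<cdot> (\<mu> B \<cdot> k) = k" if "k \<in> Arr X" "Cod X k = fobj T (fobj T B)" for k
    using Comp_assoc_arr[of k "\<mu> B" "\<eta> (fobj T B)"] that B by (simp add: unit_ftor_mult)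
  assume s: "?s = \<one> ?S"
  have g: "?g \<in> hom X ?P ?S"
    using A B by (simp add: in_hom_iff)
  have "?g \<cdot> ?h = ?g\<^sub>1 \<cdot> ?h \<^bold>+ ?g\<^sub>2 \<cdot> ?h"
    by (rule arr_sum_Comp) (use A B in simp_all)
  also have "?g\<^sub>1 \<cdot> ?h = farr T (\<iota>\<^sub>1 A (fobj T B) \<cdot> \<pi>\<^sub>1 A (fobj T B))"
    using A B by (simp add: projection_fusion_operator ftor_Comp)
  also have "?g\<^sub>2 \<cdot> ?h = farr T (\<iota>\<^sub>2 A (fobj T B) \<cdot> \<pi>\<^sub>2 A (fobj T B))"
    using A B by (simp add: projection_fusion_operator ftor_Comp mult)
  finally have gh: "?g \<cdot> ?h = \<one> ?S"
    using s by simp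
  \<comment> \<open>Componentwise, the off-diagonal terms are zero; the diagonal ones reduce to the
    two projections, the second by \<open>unit\<close>.\<close>
  have hg: "?h \<cdot> ?g = \<one> ?P"
    by (rule projections_jointly_monic[where A = "fobj T A" and B = "fobj T B"])
      (use A B in \<open>simp_all add: projection_fusion_operator_Comp Comp_arr_sum unit\<close>)
  show "isomorphism X ?h"
    unfolding isomorphism_def using A B g gh hg by auto
qed

end

theorem proposition5p4:
  fixes X :: "('o, 'm, 'z) biprod_cat_scheme" (structure)
    and T :: "('o, 'm, 'o, 'm) ftor"
    and \<mu> :: "'o \<Rightarrow> 'm" and \<eta> :: "'o \<Rightarrow> 'm"
  assumes "finite_biproducts X"
    and "idempotent_monad X T \<mu> \<eta>"
  shows "Hopf_monad X T \<mu> \<eta> \<longleftrightarrow>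
    (\<forall>A \<in> Obj X. \<forall>B \<in> Obj X.
      farr T (\<iota>\<^sub>1 A (fobj T B) \<cdot> \<pi>\<^sub>1 A (fobj T B)) \<^bold>+ farr T (\<iota>\<^sub>2 A (fobj T B) \<cdot> \<pi>\<^sub>2 A (fobj T B))
        = \<one> (fobj T (A \<oplus> fobj T B)))"
proof -
  interpret finite_biproducts X by fact
  interpret monad X T \<mu> \<eta>
    using assms(2) by (simp add: idempotent_monad_def)
  \<comment> \<open>The remaining obligation is invertibility of each \<open>\<mu> A\<close>, read
    off from the natural isomorphism.\<close>
  interpret idempotent_biproduct_monad X T \<mu> \<eta>
    by unfold_locales (use assms(2) in \<open>simp add: idempotent_monad_def natural_isomorphism_def\<close>)
  show ?thesis
    by (simp add: Hopf_monad_iff fusion_operator_isomorphism_iff)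
qed

end
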